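(* Let $N,N_p,M\in\mathbb N$ with $N_p\ge2$, $M\ge 1$, $\Delta t>0$, $\varepsilon>0$, $\gamma_1,\dots,\gamma_N>0$, and let $\mathbf v_k=J\nabla h_k$ for $k=1,\dots,N$. Fix initial markers $X_0^1,\dots,X_0^{N_p}$ and discrete controls $u=\{u_{k,n}\}$, $1\le k\le N$, $0\le n\le M-1$. Let $X_n^j$ be the marker trajectories produced by the implicit midpoint scheme $$X_{n+1}^j=X_n^j+\Delta t\sum_{k=1}^Nu_{k,n}\,\mathbf v_k\!\Bigl(\tfrac{X_n^j+X_{n+1}^j}2\Bigr),\qquad 0\le n\le M-1,\ 1\le j\le N_p,$$ assuming that the implicit relation is solved exactly and that, near the trajectory and the given controls, it defines $X_{n+1}^j$ as a differentiable function of $X_n^j$ and of $(u_{1,n},\dots,u_{N,n})$. Let $$J_h(u)=-\sum_{j=1}^{N_p-1}\sqrt{|X_M^{j+1}-X_M^j|^2+\varepsilon^2}+\frac{\Delta t}2\sum_{n=0}^{M-1}\sum_{k=1}^N\gamma_ku_{k,n}^2 .$$ Define $p_M^j=\partial_{X_M^j}\Bigl(-\sum_{i=1}^{N_p-1}\sqrt{|X_M^{i+1}-X_M^i|^2+\varepsilon^2}\Bigr)$ and, backward in $n$, let $p_n^j$ solve $$p_n^j=p_{n+1}^j+\Delta t\,(G_n^j)^\top\frac{p_n^j+p_{n+1}^j}2,\qquad G_n^j=\sum_{k=1}^Nu_{k,n}\nabla\mathbf v_k\!\Bigl(\tfrac{X_n^j+X_{n+1}^j}2\Bigr).$$ Then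 this backward recursion coincides with $p_n^j=(\Phi_n^j)^\top p_{n+1}^j$, where $\Phi_n^j=\partial X_{n+1}^j/\partial X_n^j$ is the one-step Jacobian, and the exact gradient of $J_h$ is given by $$\frac{\partial J_h}{\partial u_{k,n}}=\gamma_k\Delta t\,u_{k,n}+\Delta t\sum_{j=1}^{N_p}\frac{p_n^j+p_{n+1}^j}2\cdot\mathbf v_k\!\Bigl(\tfrac{X_n^j+X_{n+1}^j}2\Bigr),\qquad 1\le k\le N,\ 0\le n\le M-1.$$
   Context: $J=\begin{pmatrix}0&-1\\1&0\end{pmatrix}$. The basis functions $h_1,\dots,h_N$ are smooth stream functions in $C^\infty(\overline\Omega)\cap H^1_0(\Omega)$ on a bounded simply connected planar domain $\Omega$ with $C^2$ boundary; all midpoints $\tfrac12(X_n^j+X_{n+1}^j)$ are assumed to lie in $\Omega$. $\nabla\mathbf v_k$ denotes the Jacobian matrix of $\mathbf v_k$, so $\nabla\mathbf v_k=J\nabla^2h_k$. The initial markers do not depend on $u$, and $J_h$ is regarded as a function of $u$ through the trajectory $X_n^j$ (the locally defined solution of the scheme). All implicit equations are taken to be solved exactly. *)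

theory Defs
  imports "HOL-Analysis.Analysis"
begin

section \<open>Smooth functions and Sobolev spaces on a planar domain\<close>

definition pd :: "2 \<Rightarrow> (real^2 \<Rightarrow> real) \<Rightarrow> real^2 \<Rightarrow> real" where
  "pd i f x = frechet_derivative f (at x) (axis i 1)"

definition grad :: "(real^2 \<Rightarrow> real) \<Rightarrow> real^2 \<Rightarrow> real^2" where
  "grad f x = (\<chi> i. pd i f x)"

definition iter_pd :: "2 list \<Rightarrow> (real^2 \<Rightarrow> real) \<Rightarrow> real^2 \<Rightarrow> real" where
  "iter_pd is f = foldr pd is f"

definition smooth_on :: "(real^2) set \<Rightarrow> (real^2 \<Rightarrow> real) \<Rightarrow> bool" where
  "smooth_on S f \<longleftrightarrow> (\<forall>is. \<forall>x\<in>S. iter_pd is f differentiable (at x))"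

(* C^infinity of the closure of an open set: smooth inside, and every partial
   derivative extends continuously to the closure. *)
definition smooth_closure :: "(real^2) set \<Rightarrow> (real^2 \<Rightarrow> real) \<Rightarrow> bool" where
  "smooth_closure \<Omega> f \<longleftrightarrow> smooth_on \<Omega> f \<and> continuous_on (closure \<Omega>) f \<and>
     (\<forall>is. \<exists>g. continuous_on (closure \<Omega>) g \<and> (\<forall>x\<in>\<Omega>. g x = iter_pd is f x))"

definition test_fun :: "(real^2) set \<Rightarrow> (real^2 \<Rightarrow> real) \<Rightarrow> bool" where
  "test_fun \<Omega> \<phi> \<longleftrightarrow> smooth_on UNIV \<phi> \<and>
     compact (closure {x. \<phi> x \<noteq> 0}) \<and> closure {x. \<phi> x \<noteq> 0} \<subseteq> \<Omega>"

definition L2_on :: "(real^2) set \<Rightarrow> (real^2 \<Rightarrow> 'b::euclidean_space) \<Rightarrow> bool" where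
  "L2_on \<Omega> f \<longleftrightarrow> f \<in> borel_measurable (lebesgue_on \<Omega>) \<and>
     integrable (lebesgue_on \<Omega>) (\<lambda>x. (norm (f x))\<^sup>2)"

definition weak_gradient ::
  "(real^2) set \<Rightarrow> (real^2 \<Rightarrow> real) \<Rightarrow> (real^2 \<Rightarrow> real^2) \<Rightarrow> bool" where
  "weak_gradient \<Omega> f g \<longleftrightarrow> (\<forall>\<phi> i. test_fun \<Omega> \<phi> \<longrightarrow>
     (LINT x|lebesgue_on \<Omega>. f x * pd i \<phi> x) = - (LINT x|lebesgue_on \<Omega>. g x $ i * \<phi> x))"

(* H^1_0: closure of the test functions in the H^1 norm. *)
definition H10 :: "(real^2) set \<Rightarrow> (real^2 \<Rightarrow> real) set" where
  "H10 \<Omega> = {f. \<exists>g. L2_on \<Omega> f \<and> L2_on \<Omega> g \<and> weak_gradient \<Omega> f g \<and>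
     (\<exists>\<phi>::nat \<Rightarrow> real^2 \<Rightarrow> real. (\<forall>m. test_fun \<Omega> (\<phi> m)) \<and>
       (\<lambda>m. (LINT x|lebesgue_on \<Omega>. (f x - \<phi> m x)\<^sup>2) +
             (LINT x|lebesgue_on \<Omega>. (norm (g x - grad (\<phi> m) x))\<^sup>2)) \<longlonglongrightarrow> 0)}"

definition C2_real :: "(real \<Rightarrow> real) \<Rightarrow> bool" where
  "C2_real \<psi> \<longleftrightarrow> (\<exists>\<psi>' \<psi>''. (\<forall>t. (\<psi> has_real_derivative \<psi>' t) (at t)) \<and>
     (\<forall>t. (\<psi>' has_real_derivative \<psi>'' t) (at t)) \<and> continuous_on UNIV \<psi>'')"

(* Locally, up to a rigid motion, the set is the strict epigraph of a C^2 function. *)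
definition C2_boundary :: "(real^2) set \<Rightarrow> bool" where
  "C2_boundary \<Omega> \<longleftrightarrow> (\<forall>z \<in> frontier \<Omega>. \<exists>r>0. \<exists>T \<psi>.
     orthogonal_transformation (T :: real^2 \<Rightarrow> real^2) \<and> C2_real \<psi> \<and>
     \<Omega> \<inter> ball z r = {x \<in> ball z r. T (x - z) $ 2 > \<psi> (T (x - z) $ 1)})"

definition C2_domain :: "(real^2) set \<Rightarrow> bool" where
  "C2_domain \<Omega> \<longleftrightarrow> \<Omega> \<noteq> {} \<and> open \<Omega> \<and> connected \<Omega> \<and> bounded \<Omega> \<and>
     simply_connected \<Omega> \<and> C2_boundary \<Omega>"


section \<open>Velocity fields, the implicit midpoint scheme, the discrete cost\<close>

definition Jmat :: "real^2^2" where
  "Jmat = vector [vector [0, -1], vector [1, 0]]"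

definition velocity :: "(real^2 \<Rightarrow> real) \<Rightarrow> real^2 \<Rightarrow> real^2" where
  "velocity h x = Jmat *v grad h x"

definition midpoint_step ::
  "real \<Rightarrow> ('k::finite \<Rightarrow> real^2 \<Rightarrow> real^2) \<Rightarrow> real^'k \<Rightarrow> real^2 \<Rightarrow> real^2 \<Rightarrow> bool" where
  "midpoint_step \<Delta>t v w x y \<longleftrightarrow> y = x + \<Delta>t *\<^sub>R (\<Sum>k\<in>UNIV. w $ k *\<^sub>R v k (midpoint x y))"

(* Near ((x0,w0),y0), the graph of F is exactly the solution set of the midpoint relation,
   and F is differentiable. Asking for midpoints in Omega, where the fields live, only
   shrinks the neighbourhoods. Outside U the values of F are arbitrary. *)
definition locally_defines_step ::
  "(real^2) set \<Rightarrow> real \<Rightarrow> ('k::finite \<Rightarrow> real^2 \<Rightarrow> real^2) \<Rightarrow>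
     ((real^2) \<times> (real^'k) \<Rightarrow> real^2) \<Rightarrow> real^2 \<Rightarrow> real^'k \<Rightarrow> real^2 \<Rightarrow> bool" where
  "locally_defines_step \<Omega> \<Delta>t v F x0 w0 y0 \<longleftrightarrow>
     (\<exists>U V. open U \<and> (x0, w0) \<in> U \<and> open V \<and> y0 \<in> V \<and>
        F ` U \<subseteq> V \<and> F differentiable_on U \<and>
        (\<forall>(x, w)\<in>U. \<forall>y\<in>V. midpoint x y \<in> \<Omega> \<and>
            (midpoint_step \<Delta>t v w x y \<longleftrightarrow> y = F (x, w))))"

(* Trajectory generated by the one-step solution maps F n j from the initial markers X0. *)
primrec traj ::
  "(nat \<Rightarrow> nat \<Rightarrow> (real^2) \<times> (real^'k) \<Rightarrow> real^2) \<Rightarrow> (nat \<Rightarrow> real^2) \<Rightarrow>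
     (nat \<Rightarrow> real^'k::finite) \<Rightarrow> nat \<Rightarrow> nat \<Rightarrow> real^2" where
  "traj F X0 w 0 j = X0 j"
| "traj F X0 w (Suc n) j = F n j (traj F X0 w n j, w n)"

definition reg_length :: "nat \<Rightarrow> real \<Rightarrow> (nat \<Rightarrow> real^2) \<Rightarrow> real" where
  "reg_length Np \<epsilon> Y = (\<Sum>j = 1..Np - 1. sqrt ((norm (Y (j + 1) - Y j))\<^sup>2 + \<epsilon>\<^sup>2))"

definition cost ::
  "nat \<Rightarrow> nat \<Rightarrow> real \<Rightarrow> real \<Rightarrow> ('k::finite \<Rightarrow> real) \<Rightarrow>
     (nat \<Rightarrow> nat \<Rightarrow> (real^2) \<times> (real^'k) \<Rightarrow> real^2) \<Rightarrow> (nat \<Rightarrow> real^2) \<Rightarrow>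
     (nat \<Rightarrow> real^'k) \<Rightarrow> real" where
  "cost Np M \<Delta>t \<epsilon> \<gamma> F X0 w = - reg_length Np \<epsilon> (traj F X0 w M)
     + \<Delta>t / 2 * (\<Sum>n<M. \<Sum>k\<in>UNIV. \<gamma> k * (w n $ k)\<^sup>2)"

definition upd_control ::
  "(nat \<Rightarrow> real^'k::finite) \<Rightarrow> 'k \<Rightarrow> nat \<Rightarrow> real \<Rightarrow> nat \<Rightarrow> real^'k" where
  "upd_control u k n s = u(n := (\<chi> i. if i = k then s else u n $ i))"

(* g is the (Frechet) gradient at u of a function of the M*N numbers w n $ k, n < M. *)
definition has_control_gradient ::
  "nat \<Rightarrow> ((nat \<Rightarrow> real^'k::finite) \<Rightarrow> real) \<Rightarrow> (nat \<Rightarrow> real^'k) \<Rightarrow> (nat \<Rightarrow> real^'k) \<Rightarrow> bool" where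
  "has_control_gradient M f g u \<longleftrightarrow> (\<forall>e>0. \<exists>d>0. \<forall>w.
     L2_set (\<lambda>n. norm (w n - u n)) {..<M} < d \<longrightarrow>
     \<bar>f w - f u - (\<Sum>n<M. g n \<bullet> (w n - u n))\<bar>
       \<le> e * L2_set (\<lambda>n. norm (w n - u n)) {..<M})"

end

theory Submission
  imports Defs
begin

text \<open>
  Differentiating the midpoint relation \<open>y = x + \<Delta>t (\<Sum>k. w\<^sub>k v\<^sub>k((x + y)/2))\<close>, which holds
  identically along the local solution map, shows that a perturbation \<open>a\<close> of the marker and
  \<open>c\<close> of the control lead to a perturbation \<open>d\<close> of the next marker with
  \<open>d = a + \<Delta>t (\<Sum>k. c\<^sub>k v\<^sub>k) + \<Delta>t G ((a + d)/2)\<close>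
  (\<open>locally_defines_step_derivative\<close>). The adjoint step \<open>p = q + \<Delta>t G\<^sup>T ((p + q)/2)\<close> is
  built so that, after pairing with \<open>(p + q)/2\<close>, the term in \<open>G\<close> becomes
  \<open>(p - q) \<bullet> (a + d)/2\<close>, which leaves only boundary terms: \<open>q \<bullet> d = p \<bullet> a + ((p + q)/2) \<bullet> \<Delta>t (\<Sum>k. c\<^sub>k v\<^sub>k)\<close>
  (\<open>midpoint_adjoint_identity\<close>).

  For \<open>c = 0\<close> this identity says \<open>p = \<Phi>\<^sup>T q\<close>. Conversely \<open>\<Phi>\<^sup>T q\<close> solves the
  adjoint step: with \<open>B = (\<Delta>t/2) G\<close> the linearized relation reads
  \<open>(1 - B)(1 + \<Phi>) = 2\<close>, so the invertibility of \<open>1 - B\<close> is automatic and the two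
  factors commute (\<open>implicit_midpoint_transpose_iff\<close>).

  For general \<open>c\<close>, summation over the time steps telescopes. Since the marker perturbations
  vanish at time \<open>0\<close>, only the pairing with the terminal values of \<open>p\<close>, which is the
  differential of the terminal cost, and the control terms remain (\<open>lin_traj_adjoint\<close>,
  \<open>cost_has_derivative\<close>). The derivative of the cost is computed along an arbitrary
  differentiable family of controls over a normed space. The space of bounded sequences then gives
  the Frechet gradient, and the real line the partial derivatives.
\<close>

section \<open>Gradients and velocity fields\<close>

lemma differentiable_grad:
  assumes "\<And>i. pd i f differentiable (at x)"
  shows "grad f differentiable (at x)"
proof -
  have "\<exists>D. \<forall>i. (pd i f has_derivative D i) (at x)"
    using assms unfolding differentiable_def by metis
  then obtain D where D: "\<And>i. (pd i f has_derivative D i) (at x)" by blast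
  have "(grad f has_derivative (\<lambda>y. \<chi> i. D i y)) (at x)"
    unfolding has_derivative_componentwise_within[of "grad f"]
    using D by (auto simp: Basis_vec_def inner_axis grad_def)
  then show ?thesis unfolding differentiable_def by blast
qed

lemma grad_inner:
  assumes D: "(f has_derivative D) (at x)"
  shows "grad f x \<bullet> a = D a"
proof -
  have lin: "linear D" using D by (rule has_derivative_linear)
  have "D a = D (\<Sum>i\<in>UNIV. a $ i *\<^sub>R axis i 1)"
    by (simp only: basis_expansion scalar_mult_eq_scaleR[symmetric])
  also have "\<dots> = (\<Sum>i\<in>UNIV. a $ i * D (axis i 1))"
    by (simp add: linear_sum[OF lin] linear_cmul[OF lin])
  also have "\<dots> = grad f x \<bullet> a"
    by (simp add: grad_def pd_def frechet_derivative_at[OF D, symmetric] inner_vec_def mult.commute)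
  finally show ?thesis ..
qed

lemma differentiable_velocity:
  assumes "smooth_on S h" "x \<in> S"
  shows "velocity h differentiable (at x)"
proof -
  have "pd i h differentiable (at x)" for i
    using assms unfolding smooth_on_def iter_pd_def by (auto dest!: spec[of _ "[i]"])
  then have "grad h differentiable (at x)" by (rule differentiable_grad)
  then obtain D where D: "(grad h has_derivative D) (at x)" unfolding differentiable_def by blast
  have "((\<lambda>x. Jmat *v grad h x) has_derivative (\<lambda>y. Jmat *v D y)) (at x)"
    by (rule bounded_linear.has_derivative[OF _ D]) (rule matrix_vector_mul_bounded_linear)
  then show ?thesis unfolding differentiable_def velocity_def[abs_def] by blast
qed

section \<open>One midpoint step and its adjoint\<close>

lemma sum_matrix_vector_mult:
  fixes A :: "'a \<Rightarrow> real^'n^'m"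
  shows "(\<Sum>k\<in>S. A k) *v y = (\<Sum>k\<in>S. A k *v y)"
  by (induction S rule: infinite_finite_induct) (simp_all add: matrix_vector_mult_add_rdistrib)

text \<open>The solution map stays in the neighbourhood in which the midpoint relation characterizes it,
  so the relation can be differentiated as an identity between functions.\<close>

lemma locally_defines_step_derivative:
  fixes v :: "'k::finite \<Rightarrow> real^2 \<Rightarrow> real^2"
  assumes loc: "locally_defines_step \<Omega> \<Delta>t v F x0 w0 y0"
    and step: "midpoint_step \<Delta>t v w0 x0 y0"
    and diff: "\<And>k. v k differentiable (at (midpoint x0 y0))"
    and G: "G = (\<Sum>k\<in>UNIV. w0 $ k *\<^sub>R jacobian (v k) (at (midpoint x0 y0)))"
  obtains D where "F (x0, w0) = y0" "(F has_derivative D) (at (x0, w0))"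
    "\<And>a c. D (a, c) = a + \<Delta>t *\<^sub>R (\<Sum>k\<in>UNIV. c $ k *\<^sub>R v k (midpoint x0 y0))
                        + \<Delta>t *\<^sub>R (G *v midpoint a (D (a, c)))"
proof -
  let ?m = "midpoint x0 y0"
  obtain U V where U: "open U" "(x0, w0) \<in> U" and V: "y0 \<in> V" and FU: "F ` U \<subseteq> V"
    and dF: "F differentiable_on U"
    and sol: "\<forall>(x, w)\<in>U. \<forall>y\<in>V. midpoint x y \<in> \<Omega> \<and>
            (midpoint_step \<Delta>t v w x y \<longleftrightarrow> y = F (x, w))"
    using loc unfolding locally_defines_step_def by (elim exE conjE) (rule that)
  have iff: "midpoint_step \<Delta>t v w x y \<longleftrightarrow> y = F (x, w)" if "(x, w) \<in> U" "y \<in> V" for x w y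
    using bspec[OF sol that(1)] that(2) by simp
  have F0: "F (x0, w0) = y0" using iff[OF U(2) V] step by simp
  obtain D where D: "(F has_derivative D) (at (x0, w0))"
    using dF U by (metis differentiable_def differentiable_on_def at_within_open)
  have fst': "(fst has_derivative fst) (at (x0, w0))"
    and snd': "((\<lambda>z. snd z $ k) has_derivative (\<lambda>z. snd z $ k)) (at (x0, w0))" for k
    by (auto intro!: derivative_eq_intros bounded_linear_imp_has_derivative
        bounded_linear_fst bounded_linear_vec_nth[THEN bounded_linear_compose] bounded_linear_snd)
  let ?mid = "\<lambda>z. midpoint (fst z) (F z)"
  have mid': "(?mid has_derivative (\<lambda>z. midpoint (fst z) (D z))) (at (x0, w0))"
    unfolding midpoint_def by (intro derivative_intros fst' D)
  \<comment> \<open>The midpoint of \<open>(x0, F (x0, w0))\<close> is that of the given step, where \<open>v k\<close> is differentiable.\<close>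
  have v': "((\<lambda>z. v k (?mid z)) has_derivative
      (\<lambda>z. jacobian (v k) (at ?m) *v midpoint (fst z) (D z))) (at (x0, w0))" for k
    by (rule has_derivative_compose[OF mid', of "v k"])
      (use diff[of k] in \<open>simp add: F0 jacobian_works\<close>)
  have term': "((\<lambda>z. snd z $ k *\<^sub>R v k (?mid z)) has_derivative
      (\<lambda>z. w0 $ k *\<^sub>R (jacobian (v k) (at ?m) *v midpoint (fst z) (D z)) + snd z $ k *\<^sub>R v k ?m))
      (at (x0, w0))" for k
    using has_derivative_scaleR[OF snd'[of k] v'[of k]] by (simp add: F0)
  have rhs: "((\<lambda>z. fst z + \<Delta>t *\<^sub>R (\<Sum>k\<in>UNIV. snd z $ k *\<^sub>R v k (?mid z))) has_derivative
     (\<lambda>z. fst z + \<Delta>t *\<^sub>R (\<Sum>k\<in>UNIV. w0 $ k *\<^sub>R (jacobian (v k) (at ?m) *v midpoint (fst z) (D z))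
                                      + snd z $ k *\<^sub>R v k ?m))) (at (x0, w0))"
    by (intro has_derivative_add fst' has_derivative_scaleR_right has_derivative_sum term')
  have eq: "F z = fst z + \<Delta>t *\<^sub>R (\<Sum>k\<in>UNIV. snd z $ k *\<^sub>R v k (?mid z))" if "z \<in> U" for z
    using iff[of "fst z" "snd z" "F z"] that FU unfolding midpoint_step_def by auto
  have "(F has_derivative
     (\<lambda>z. fst z + \<Delta>t *\<^sub>R (\<Sum>k\<in>UNIV. w0 $ k *\<^sub>R (jacobian (v k) (at ?m) *v midpoint (fst z) (D z))
                                      + snd z $ k *\<^sub>R v k ?m))) (at (x0, w0))"
    by (rule has_derivative_transform_within_open[OF rhs U]) (simp add: eq)
  from has_derivative_unique[OF D this]
  have "D (a, c) = a + \<Delta>t *\<^sub>R (\<Sum>k\<in>UNIV. w0 $ k *\<^sub>R (jacobian (v k) (at ?m) *v midpoint a (D (a, c)))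
                                      + c $ k *\<^sub>R v k ?m)" for a c
    by (rule fun_cong[THEN trans]) (simp only: fst_conv snd_conv)
  moreover have "G *v y = (\<Sum>k\<in>UNIV. w0 $ k *\<^sub>R (jacobian (v k) (at ?m) *v y))" for y
    unfolding G by (simp add: sum_matrix_vector_mult scaleR_matrix_vector_assoc)
  ultimately have "D (a, c) = a + \<Delta>t *\<^sub>R (\<Sum>k\<in>UNIV. c $ k *\<^sub>R v k ?m)
                        + \<Delta>t *\<^sub>R (G *v midpoint a (D (a, c)))" for a c
    by (simp add: sum.distrib scaleR_add_right algebra_simps)
  with F0 D show thesis by (rule that)
qed

lemma midpoint_adjoint_identity:
  fixes G :: "real^'n^'n"
  assumes d: "d = a + f + \<Delta>t *\<^sub>R (G *v midpoint a d)"
    and p: "p = q + \<Delta>t *\<^sub>R (transpose G *v midpoint p q)"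
  shows "q \<bullet> d = p \<bullet> a + midpoint p q \<bullet> f"
proof -
  let ?m = "midpoint p q"
  have "?m \<bullet> (d - a) = ?m \<bullet> f + \<Delta>t *\<^sub>R (transpose G *v ?m) \<bullet> midpoint a d"
    by (subst d) (simp add: inner_add_right dot_lmul_matrix[symmetric] dot_matrix_vector_mul)
  also have "\<Delta>t *\<^sub>R (transpose G *v ?m) = p - q" by (subst (2) p) simp
  finally show ?thesis
    by (simp add: midpoint_def inner_simps algebra_simps inner_commute)
qed

text \<open>The matrix \<open>\<Phi>\<close> is the Cayley transform of \<open>(\<Delta>t/2) G\<close>. That the implicit
  adjoint step has exactly one solution needs no smallness of \<open>\<Delta>t\<close>: the existence of
  \<open>\<Phi>\<close> already forces \<open>1 - (\<Delta>t/2) G\<close> to be invertible.\<close>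

lemma implicit_midpoint_transpose_iff:
  fixes G \<Phi> :: "real^'n^'n"
  assumes \<Phi>: "\<And>a. \<Phi> *v a = a + \<Delta>t *\<^sub>R (G *v midpoint a (\<Phi> *v a))"
  shows "r = q + \<Delta>t *\<^sub>R (transpose G *v midpoint r q) \<longleftrightarrow> r = transpose \<Phi> *v q"
proof
  assume "r = q + \<Delta>t *\<^sub>R (transpose G *v midpoint r q)"
  then have "q \<bullet> (\<Phi> *v a) = r \<bullet> a" for a
    using midpoint_adjoint_identity[of "\<Phi> *v a" a 0 \<Delta>t G r q] \<Phi>[of a] by simp
  then have "r \<bullet> a = (transpose \<Phi> *v q) \<bullet> a" for a
    by (simp add: dot_lmul_matrix)
  then show "r = transpose \<Phi> *v q"
    using vector_eq_rdot by blast
next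
  assume r: "r = transpose \<Phi> *v q"
  define B where "B = (\<Delta>t / 2) *\<^sub>R G"
  have Bv: "B *v x = (\<Delta>t / 2) *\<^sub>R (G *v x)" for x by (simp add: B_def scaleR_matrix_vector_assoc)
  have "(1/2) *\<^sub>R (mat 1 - B) ** (mat 1 + \<Phi>) = mat 1"
    unfolding matrix_eq
  proof
    fix a
    have "\<Phi> *v a - a = \<Delta>t *\<^sub>R (G *v midpoint a (\<Phi> *v a))"
      using \<Phi>[of a] by (metis add_diff_cancel_left')
    then have "B *v (a + \<Phi> *v a) = \<Phi> *v a - a"
      by (simp add: Bv midpoint_def matrix_vector_mult_scaleR)
    then have "(mat 1 - B) *v (a + \<Phi> *v a) = 2 *\<^sub>R a"
      by (simp add: matrix_vector_mult_diff_rdistrib scaleR_2)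
    then show "(1/2) *\<^sub>R (mat 1 - B) ** (mat 1 + \<Phi>) *v a = mat 1 *v a"
      by (simp add: matrix_vector_mul_assoc[symmetric] scaleR_matrix_vector_assoc[symmetric]
          matrix_vector_mult_add_rdistrib)
  qed
  \<comment> \<open>A one-sided inverse of a square matrix is two-sided, so the factors may be exchanged.\<close>
  then have c: "(mat 1 + \<Phi>) ** ((1/2) *\<^sub>R (mat 1 - B)) = mat 1"
    by (simp only: matrix_left_right_inverse)
  have \<Phi>B: "\<Phi> *v (a - B *v a) = a + B *v a" for a
  proof -
    let ?y = "a - B *v a"
    have "(1/2) *\<^sub>R (?y + \<Phi> *v ?y) = (mat 1 + \<Phi>) ** ((1/2) *\<^sub>R (mat 1 - B)) *v a"
      by (simp only: matrix_vector_mul_assoc[symmetric] scaleR_matrix_vector_assoc[symmetric]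
          matrix_vector_mult_scaleR matrix_vector_mult_diff_rdistrib
          matrix_vector_mult_add_rdistrib matrix_vector_mul_lid)
    then have half: "(1/2) *\<^sub>R (?y + \<Phi> *v ?y) = a" by (simp only: c matrix_vector_mul_lid)
    have dbl: "z = 2 *\<^sub>R ((1/2) *\<^sub>R z)" for z :: "real^'n" by simp
    have "?y + \<Phi> *v ?y = 2 *\<^sub>R ((1/2) *\<^sub>R (?y + \<Phi> *v ?y))" by (rule dbl)
    also have "\<dots> = 2 *\<^sub>R a" by (simp only: half)
    finally have "?y + \<Phi> *v ?y = 2 *\<^sub>R a" .
    then show "\<Phi> *v ?y = a + B *v a" by (simp add: scaleR_2 algebra_simps)
  qed
  have "(q + \<Delta>t *\<^sub>R (transpose G *v midpoint r q)) \<bullet> a = r \<bullet> a" for a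
  proof -
    have "r \<bullet> (a - B *v a) = q \<bullet> (a + B *v a)"
      unfolding r by (simp only: \<Phi>B[symmetric] dot_lmul_matrix transpose_matrix_vector)
    moreover have "\<Delta>t *\<^sub>R (transpose G *v midpoint r q) \<bullet> a = (r + q) \<bullet> (B *v a)"
      by (simp add: Bv midpoint_def matrix_vector_mult_scaleR dot_lmul_matrix)
    ultimately show ?thesis by (simp add: inner_simps)
  qed
  then show "r = q + \<Delta>t *\<^sub>R (transpose G *v midpoint r q)"
    using vector_eq_rdot by metis
qed

section \<open>The regularized length\<close>

text \<open>The segment from \<open>Y i\<close> to \<open>Y (i + 1)\<close> divided by its regularized length: the
  gradient of the \<open>i\<close>-th summand of \<open>reg_length\<close> with respect to the segment vector.\<close>

definition chord :: "real \<Rightarrow> (nat \<Rightarrow> real^2) \<Rightarrow> nat \<Rightarrow> real^2" where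
  "chord \<epsilon> Y i = (Y (i + 1) - Y i) /\<^sub>R sqrt ((norm (Y (i + 1) - Y i))\<^sup>2 + \<epsilon>\<^sup>2)"

lemma reg_length_has_derivative:
  fixes Y :: "'e::real_normed_vector \<Rightarrow> nat \<Rightarrow> real^2"
  assumes eps: "\<epsilon> > 0"
    and Y: "\<And>j. j \<in> {1..Np} \<Longrightarrow> ((\<lambda>b. Y b j) has_derivative dY j) (at b0)"
  shows "((\<lambda>b. reg_length Np \<epsilon> (Y b)) has_derivative
      (\<lambda>b. \<Sum>i = 1..Np - 1. chord \<epsilon> (Y b0) i \<bullet> (dY (i + 1) b - dY i b))) (at b0)"
  unfolding reg_length_def power2_norm_eq_inner
proof (rule has_derivative_sum)
  fix i assume i: "i \<in> {1..Np - 1}"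
  let ?d = "\<lambda>b. Y b (i + 1) - Y b i"
  have d: "(?d has_derivative (\<lambda>b. dY (i + 1) b - dY i b)) (at b0)"
    using i by (intro derivative_intros Y) auto
  have pos: "?d b0 \<bullet> ?d b0 + \<epsilon>\<^sup>2 > 0"
    using eps by (intro add_nonneg_pos) auto
  have sq: "((\<lambda>b. ?d b \<bullet> ?d b + \<epsilon>\<^sup>2) has_derivative
      (\<lambda>b. 2 * (?d b0 \<bullet> (dY (i + 1) b - dY i b)))) (at b0)"
    by (rule has_derivative_eq_rhs[OF has_derivative_add[OF has_derivative_inner[OF d d] has_derivative_const]])
      (simp only: inner_commute[of "dY (i + 1) _ - dY i _"] add_0_right mult_2)
  show "((\<lambda>b. sqrt (?d b \<bullet> ?d b + \<epsilon>\<^sup>2)) has_derivative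
      (\<lambda>b. chord \<epsilon> (Y b0) i \<bullet> (dY (i + 1) b - dY i b))) (at b0)"
    by (rule has_derivative_eq_rhs[OF has_derivative_real_sqrt[OF pos sq]])
      (simp add: chord_def power2_norm_eq_inner mult.commute)
qed

text \<open>The gradients with respect to the single markers assemble to the full differential.\<close>

lemma grad_reg_length_inner_sum:
  assumes eps: "\<epsilon> > 0"
  shows "(\<Sum>j = 1..Np. grad (\<lambda>x. - reg_length Np \<epsilon> (Y(j := x))) (Y j) \<bullet> y j)
    = - (\<Sum>i = 1..Np - 1. chord \<epsilon> Y i \<bullet> (y (i + 1) - y i))"
proof -
  have g: "grad (\<lambda>x. - reg_length Np \<epsilon> (Y(j := x))) (Y j) \<bullet> a
      = - (\<Sum>i = 1..Np - 1. chord \<epsilon> Y i \<bullet> ((if i + 1 = j then a else 0) - (if i = j then a else 0)))"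
    (is "_ = ?D a") for j a
  proof -
    have upd: "((\<lambda>x. (Y(j := x)) i) has_derivative (\<lambda>a. if i = j then a else 0)) (at (Y j))" for i
      by (cases "i = j") auto
    have "((\<lambda>x. reg_length Np \<epsilon> (Y(j := x))) has_derivative
       (\<lambda>a. \<Sum>i = 1..Np - 1. chord \<epsilon> (Y(j := Y j)) i \<bullet>
          ((if i + 1 = j then a else 0) - (if i = j then a else 0)))) (at (Y j))"
      by (rule reg_length_has_derivative[OF eps upd])
    then have D: "((\<lambda>x. - reg_length Np \<epsilon> (Y(j := x))) has_derivative ?D) (at (Y j))"
      by (simp add: has_derivative_minus)
    then show ?thesis by (rule grad_inner)
  qed
  have "(\<Sum>j = 1..Np. chord \<epsilon> Y i \<bullet> ((if i + 1 = j then y j else 0) - (if i = j then y j else 0)))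
      = chord \<epsilon> Y i \<bullet> (y (i + 1) - y i)" if "i \<in> {1..Np - 1}" for i
    using that by (subst inner_sum_right[symmetric]) (auto simp: sum_subtractf)
  then show ?thesis
    unfolding g sum_negf by (subst sum.swap) (simp only: cong: sum.cong)
qed

lemma reg_length_cong:
  "(\<And>j. j \<in> {1..Np} \<Longrightarrow> Y j = Y' j) \<Longrightarrow> reg_length Np \<epsilon> Y = reg_length Np \<epsilon> Y'"
  unfolding reg_length_def by (intro sum.cong) auto

section \<open>Linearized trajectories and the derivative of the cost\<close>

text \<open>Perturbation of one marker at time \<open>n\<close> caused by the control perturbation \<open>c\<close>, where
  \<open>D n\<close> is the differential of the \<open>n\<close>-th step map; the initial marker is not perturbed.\<close>

primrec lin_traj :: "(nat \<Rightarrow> 'a::zero \<times> 'b \<Rightarrow> 'a) \<Rightarrow> (nat \<Rightarrow> 'b) \<Rightarrow> nat \<Rightarrow> 'a" where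
  "lin_traj D c 0 = 0"
| "lin_traj D c (Suc n) = D n (lin_traj D c n, c n)"

lemma traj_has_derivative:
  fixes w :: "'e::real_normed_vector \<Rightarrow> nat \<Rightarrow> real^'k::finite"
  assumes w: "\<And>n. n < M \<Longrightarrow> ((\<lambda>b. w b n) has_derivative dw n) (at b0)"
    and F: "\<And>n. n < M \<Longrightarrow> (F n j has_derivative D n) (at (traj F X0 (w b0) n j, w b0 n))"
    and "n \<le> M"
  shows "((\<lambda>b. traj F X0 (w b) n j) has_derivative (\<lambda>b. lin_traj D (\<lambda>n. dw n b) n)) (at b0)"
  using \<open>n \<le> M\<close>
proof (induction n)
  case (Suc n)
  then have "((\<lambda>b. (traj F X0 (w b) n j, w b n)) has_derivative
      (\<lambda>b. (lin_traj D (\<lambda>n. dw n b) n, dw n b))) (at b0)"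
    by (intro has_derivative_Pair w) auto
  from has_derivative_compose[OF this, of "F n j" "D n"] F[of n] Suc.prems
  show ?case by simp
qed simp

text \<open>Discrete duality: the one-step identities telescope.\<close>

lemma lin_traj_adjoint:
  assumes "\<And>n a c. n < M \<Longrightarrow> p (Suc n) \<bullet> D n (a, c) = p n \<bullet> a + l n c"
    and "n \<le> M"
  shows "p n \<bullet> lin_traj D c n = (\<Sum>i<n. l i (c i))"
  using \<open>n \<le> M\<close> by (induction n) (auto simp: assms(1))

lemma traj_cong:
  "(\<And>i. i < n \<Longrightarrow> w i = w' i) \<Longrightarrow> traj F X0 w n j = traj F X0 w' n j"
  by (induction n) auto

lemma cost_cong:
  "(\<And>n. n < M \<Longrightarrow> w n = w' n) \<Longrightarrow> cost Np M \<Delta>t \<epsilon> \<gamma> F X0 w = cost Np M \<Delta>t \<epsilon> \<gamma> F X0 w'"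
  unfolding cost_def reg_length_def by (simp cong: traj_cong)

text \<open>The chain rule along a family of controls \<open>w b\<close>, with the state perturbations eliminated by
  an adjoint \<open>p\<close>. The vector \<open>f n j\<close> collects the direct influence of the \<open>n\<close>-th control on
  marker \<open>j\<close>, weighted by the adjoint.\<close>

lemma cost_has_derivative:
  fixes w :: "'e::real_normed_vector \<Rightarrow> nat \<Rightarrow> real^'k::finite"
    and F :: "nat \<Rightarrow> nat \<Rightarrow> (real^2) \<times> (real^'k) \<Rightarrow> real^2" and X0 :: "nat \<Rightarrow> real^2" and b0 :: 'e
  defines "Y \<equiv> traj F X0 (w b0)"
  assumes eps: "\<epsilon> > 0"
    and w: "\<And>n. n < M \<Longrightarrow> ((\<lambda>b. w b n) has_derivative dw n) (at b0)"
    and F: "\<And>n j. n < M \<Longrightarrow> j \<in> {1..Np} \<Longrightarrow>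
          (F n j has_derivative D n j) (at (Y n j, w b0 n))"
    and adj: "\<And>n j a c. n < M \<Longrightarrow> j \<in> {1..Np} \<Longrightarrow>
          p (Suc n) j \<bullet> D n j (a, c) = p n j \<bullet> a + f n j \<bullet> c"
    and final: "\<And>j. j \<in> {1..Np} \<Longrightarrow>
          p M j = grad (\<lambda>x. - reg_length Np \<epsilon> ((Y M)(j := x))) (Y M j)"
  shows "((\<lambda>b. cost Np M \<Delta>t \<epsilon> \<gamma> F X0 (w b)) has_derivative
     (\<lambda>b. \<Sum>n<M. ((\<chi> k. \<gamma> k * \<Delta>t * w b0 n $ k) + (\<Sum>j = 1..Np. f n j)) \<bullet> dw n b)) (at b0)"
proof -
  let ?l = "\<lambda>j b. lin_traj (\<lambda>n. D n j) (\<lambda>n. dw n b) M"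
  have traj': "((\<lambda>b. traj F X0 (w b) M j) has_derivative ?l j) (at b0)" if "j \<in> {1..Np}" for j
    using F that unfolding Y_def by (intro traj_has_derivative[OF w]) auto
  have len_eq: "(\<Sum>i = 1..Np - 1. chord \<epsilon> (Y M) i \<bullet> (?l (i + 1) b - ?l i b))
      = - (\<Sum>n<M. (\<Sum>j = 1..Np. f n j) \<bullet> dw n b)" for b
  proof -
    have "- (\<Sum>i = 1..Np - 1. chord \<epsilon> (Y M) i \<bullet> (?l (i + 1) b - ?l i b))
        = (\<Sum>j = 1..Np. p M j \<bullet> ?l j b)"
      by (subst grad_reg_length_inner_sum[OF eps, symmetric]) (simp add: final)
    also have "\<dots> = (\<Sum>j = 1..Np. \<Sum>n<M. f n j \<bullet> dw n b)"
      by (intro sum.cong refl lin_traj_adjoint[where p = "\<lambda>n. p n _" and M = M]) (auto simp: adj)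
    also have "\<dots> = (\<Sum>n<M. (\<Sum>j = 1..Np. f n j) \<bullet> dw n b)"
      unfolding inner_sum_left by (rule sum.swap)
    finally show ?thesis by linarith
  qed
  have len': "((\<lambda>b. - reg_length Np \<epsilon> (traj F X0 (w b) M)) has_derivative
      (\<lambda>b. \<Sum>n<M. (\<Sum>j = 1..Np. f n j) \<bullet> dw n b)) (at b0)"
    using has_derivative_minus[OF reg_length_has_derivative[where Np = Np
        and Y = "\<lambda>b. traj F X0 (w b) M" and dY = ?l, OF eps traj']]
    unfolding Y_def[symmetric] len_eq by simp
  have "((\<lambda>b. \<gamma> k * (w b n $ k)\<^sup>2) has_derivative (\<lambda>b. 2 * \<gamma> k * w b0 n $ k * dw n b $ k)) (at b0)"
    if "n < M" for n k
    by (rule has_derivative_eq_rhs, rule has_derivative_mult_right, rule has_derivative_power,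
        rule bounded_linear.has_derivative[OF bounded_linear_vec_nth w[OF that]])
      (simp add: fun_eq_iff)
  then have "((\<lambda>b. \<Delta>t / 2 * (\<Sum>n<M. \<Sum>k\<in>UNIV. \<gamma> k * (w b n $ k)\<^sup>2)) has_derivative
      (\<lambda>b. \<Delta>t / 2 * (\<Sum>n<M. \<Sum>k\<in>UNIV. 2 * \<gamma> k * w b0 n $ k * dw n b $ k))) (at b0)"
    by (intro has_derivative_mult_right has_derivative_sum) auto
  moreover have "\<Delta>t / 2 * (\<Sum>n<M. \<Sum>k\<in>UNIV. 2 * \<gamma> k * w b0 n $ k * dw n b $ k)
      = (\<Sum>n<M. (\<chi> k. \<gamma> k * \<Delta>t * w b0 n $ k) \<bullet> dw n b)" for b
    by (simp add: inner_vec_def sum_distrib_left mult_ac)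
  ultimately have "((\<lambda>b. \<Delta>t / 2 * (\<Sum>n<M. \<Sum>k\<in>UNIV. \<gamma> k * (w b n $ k)\<^sup>2)) has_derivative
      (\<lambda>b. \<Sum>n<M. (\<chi> k. \<gamma> k * \<Delta>t * w b0 n $ k) \<bullet> dw n b)) (at b0)"
    by simp
  from has_derivative_add[OF len' this] show ?thesis
    by (simp add: cost_def inner_add_left sum.distrib add.commute)
qed

section \<open>From derivatives on a normed space to control gradients\<close>

lemma bounded_linear_apply_bcontfun:
  "bounded_linear (\<lambda>b. apply_bcontfun b x)"
  for x :: "'a::topological_space"
  by (rule bounded_linear_intro[where K = 1]) (auto intro: norm_bounded)

text \<open>Infinite sequences of controls carry no norm, but only the entries below \<open>M\<close> matter.
  Perturbations cut off at \<open>M\<close> are bounded sequences, that is, bounded continuous functions on the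
  discrete space of naturals, and their supremum norm is at most the Euclidean norm.\<close>

lemma has_control_gradientI:
  fixes f :: "(nat \<Rightarrow> real^'k::finite) \<Rightarrow> real"
  assumes cong: "\<And>w w'. (\<And>n. n < M \<Longrightarrow> w n = w' n) \<Longrightarrow> f w = f w'"
    and der: "((\<lambda>b :: nat \<Rightarrow>\<^sub>C (real^'k). f (\<lambda>n. u n + apply_bcontfun b n)) has_derivative
       (\<lambda>b. \<Sum>n<M. g n \<bullet> apply_bcontfun b n)) (at 0)"
  shows "has_control_gradient M f g u"
  unfolding has_control_gradient_def
proof (intro allI impI)
  fix e :: real assume "e > 0"
  with der obtain d where "d > 0" and d: "\<And>b :: nat \<Rightarrow>\<^sub>C (real^'k). norm b < d \<Longrightarrow>
      \<bar>f (\<lambda>n. u n + apply_bcontfun b n) - f u - (\<Sum>n<M. g n \<bullet> apply_bcontfun b n)\<bar> \<le> e * norm b"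
    unfolding has_derivative_at_alt by fastforce
  show "\<exists>d>0. \<forall>w. L2_set (\<lambda>n. norm (w n - u n)) {..<M} < d \<longrightarrow>
     \<bar>f w - f u - (\<Sum>n<M. g n \<bullet> (w n - u n))\<bar> \<le> e * L2_set (\<lambda>n. norm (w n - u n)) {..<M}"
  proof (intro exI[of _ d] conjI allI impI \<open>d > 0\<close>)
    fix w assume less: "L2_set (\<lambda>n. norm (w n - u n)) {..<M} < d" (is "?L < _")
    define c where "c n = (if n < M then w n - u n else 0)" for n
    have c: "norm (c n) \<le> ?L" for n
      unfolding c_def by (auto intro!: member_le_L2_set)
    have "c \<in> bcontfun"
      by (rule bcontfun_normI[OF _ c]) (simp add: continuous_on_discrete)
    then have ap: "apply_bcontfun (Bcontfun c) = c" by (rule Bcontfun_inverse)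
    have nb: "norm (Bcontfun c) \<le> ?L"
      by (rule norm_bound) (simp add: ap c)
    have "f (\<lambda>n. u n + c n) = f w" by (rule cong) (simp add: c_def)
    then have "\<bar>f w - f u - (\<Sum>n<M. g n \<bullet> (w n - u n))\<bar> \<le> e * norm (Bcontfun c)"
      using d[of "Bcontfun c"] nb less by (simp add: ap c_def)
    also have "\<dots> \<le> e * ?L" using nb \<open>e > 0\<close> by simp
    finally show "\<bar>f w - f u - (\<Sum>n<M. g n \<bullet> (w n - u n))\<bar> \<le> e * ?L" .
  qed
qed

section \<open>The exact discrete gradient\<close>

theorem mainTheorem4:
  fixes \<Omega> :: "(real^2) set"
    and h :: "'k::finite \<Rightarrow> real^2 \<Rightarrow> real"
    and v :: "'k \<Rightarrow> real^2 \<Rightarrow> real^2"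
    and Np M :: nat
    and \<Delta>t \<epsilon> :: real
    and \<gamma> :: "'k \<Rightarrow> real"
    and X0 :: "nat \<Rightarrow> real^2"
    and u :: "nat \<Rightarrow> real^'k"
    and X :: "nat \<Rightarrow> nat \<Rightarrow> real^2"
    and F :: "nat \<Rightarrow> nat \<Rightarrow> (real^2) \<times> (real^'k) \<Rightarrow> real^2"
    and G \<Phi> :: "nat \<Rightarrow> nat \<Rightarrow> real^2^2"
    and p :: "nat \<Rightarrow> nat \<Rightarrow> real^2"
    and Jh :: "(nat \<Rightarrow> real^'k) \<Rightarrow> real"
    and g :: "nat \<Rightarrow> real^'k"
  assumes dom: "C2_domain \<Omega>"
    and basis: "\<And>k. smooth_closure \<Omega> (h k) \<and> h k \<in> H10 \<Omega>"
    and v_eq: "\<And>k. v k = velocity (h k)"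
    and Np: "Np \<ge> 2" and M: "M \<ge> 1"
    and dt: "\<Delta>t > 0" and eps: "\<epsilon> > 0" and gam: "\<And>k. \<gamma> k > 0"
    and init: "\<And>j. j \<in> {1..Np} \<Longrightarrow> X 0 j = X0 j"
    and scheme: "\<And>n j. n < M \<Longrightarrow> j \<in> {1..Np} \<Longrightarrow>
          midpoint_step \<Delta>t v (u n) (X n j) (X (Suc n) j)"
    and mid: "\<And>n j. n < M \<Longrightarrow> j \<in> {1..Np} \<Longrightarrow> midpoint (X n j) (X (Suc n) j) \<in> \<Omega>"
    and solv: "\<And>n j. n < M \<Longrightarrow> j \<in> {1..Np} \<Longrightarrow>
          locally_defines_step \<Omega> \<Delta>t v (F n j) (X n j) (u n) (X (Suc n) j)"
    and Jh_eq: "Jh = cost Np M \<Delta>t \<epsilon> \<gamma> F X0"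
    and G_eq: "\<And>n j. n < M \<Longrightarrow> j \<in> {1..Np} \<Longrightarrow>
          G n j = (\<Sum>k\<in>UNIV. u n $ k *\<^sub>R jacobian (v k) (at (midpoint (X n j) (X (Suc n) j))))"
    and Phi_eq: "\<And>n j. n < M \<Longrightarrow> j \<in> {1..Np} \<Longrightarrow>
          \<Phi> n j = jacobian (\<lambda>x. F n j (x, u n)) (at (X n j))"
    and p_final: "\<And>j. j \<in> {1..Np} \<Longrightarrow>
          p M j = grad (\<lambda>x. - reg_length Np \<epsilon> ((X M)(j := x))) (X M j)"
    and p_step: "\<And>n j. n < M \<Longrightarrow> j \<in> {1..Np} \<Longrightarrow>
          p n j = p (Suc n) j + \<Delta>t *\<^sub>R (transpose (G n j) *v midpoint (p n j) (p (Suc n) j))"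
    and g_eq: "\<And>n. n < M \<Longrightarrow> g n = (\<chi> k. \<gamma> k * \<Delta>t * u n $ k +
          \<Delta>t * (\<Sum>j = 1..Np. midpoint (p n j) (p (Suc n) j) \<bullet>
                               v k (midpoint (X n j) (X (Suc n) j))))"
  shows "(\<forall>n<M. \<forall>j\<in>{1..Np}. \<forall>q r.
             (r = q + \<Delta>t *\<^sub>R (transpose (G n j) *v midpoint r q)) \<longleftrightarrow> r = transpose (\<Phi> n j) *v q)
       \<and> (\<forall>n<M. \<forall>j\<in>{1..Np}. p n j = transpose (\<Phi> n j) *v p (Suc n) j)
       \<and> has_control_gradient M Jh g u
       \<and> (\<forall>n<M. \<forall>k. ((\<lambda>s. Jh (upd_control u k n s)) has_real_derivative g n $ k) (at (u n $ k)))"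
proof -
  have v_diff: "v k differentiable (at (midpoint (X n j) (X (Suc n) j)))"
    if "n < M" "j \<in> {1..Np}" for k n j
    using basis[of k] mid[OF that] unfolding v_eq smooth_closure_def
    by (blast intro: differentiable_velocity)
  define D where "D n j = frechet_derivative (F n j) (at (X n j, u n))" for n j
  have F_X: "F n j (X n j, u n) = X (Suc n) j"
    and F_D: "(F n j has_derivative D n j) (at (X n j, u n))"
    and D_eq: "D n j (a, c) = a + \<Delta>t *\<^sub>R (\<Sum>k\<in>UNIV. c $ k *\<^sub>R v k (midpoint (X n j) (X (Suc n) j)))
                        + \<Delta>t *\<^sub>R (G n j *v midpoint a (D n j (a, c)))"
    if nj: "n < M" "j \<in> {1..Np}" for n j a c
  proof -
    obtain D' where D': "F n j (X n j, u n) = X (Suc n) j"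
      "(F n j has_derivative D') (at (X n j, u n))"
      "\<And>a c. D' (a, c) = a + \<Delta>t *\<^sub>R (\<Sum>k\<in>UNIV. c $ k *\<^sub>R v k (midpoint (X n j) (X (Suc n) j)))
                        + \<Delta>t *\<^sub>R (G n j *v midpoint a (D' (a, c)))"
      by (rule locally_defines_step_derivative[OF solv[OF nj] scheme[OF nj] v_diff[OF nj] G_eq[OF nj]])
        blast
    moreover have "D n j = D'" unfolding D_def by (rule frechet_derivative_at[OF D'(2), symmetric])
    ultimately show "F n j (X n j, u n) = X (Suc n) j" "(F n j has_derivative D n j) (at (X n j, u n))"
      "D n j (a, c) = a + \<Delta>t *\<^sub>R (\<Sum>k\<in>UNIV. c $ k *\<^sub>R v k (midpoint (X n j) (X (Suc n) j)))
                        + \<Delta>t *\<^sub>R (G n j *v midpoint a (D n j (a, c)))"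
      by simp_all
  qed
  have traj_u: "traj F X0 u n j = X n j" if "n \<le> M" "j \<in> {1..Np}" for n j
    using that(1) by (induction n) (simp_all add: init[OF that(2)] F_X[OF _ that(2)])
  have \<Phi>_D: "\<Phi> n j *v a = D n j (a, 0)" if nj: "n < M" "j \<in> {1..Np}" for n j a
  proof -
    have "((\<lambda>x. F n j (x, u n)) has_derivative (\<lambda>a. D n j (a, 0))) (at (X n j))"
      by (rule has_derivative_compose[OF has_derivative_Pair[OF has_derivative_ident has_derivative_const]])
        (simp add: F_D[OF nj])
    then have "\<Phi> n j = matrix (\<lambda>a. D n j (a, 0))" and "linear (\<lambda>a. D n j (a, 0))"
      by (simp_all add: Phi_eq[OF nj] jacobian_def frechet_derivative_at[symmetric] has_derivative_linear)
    then show ?thesis by (simp add: matrix_works)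
  qed
  have step_iff: "r = q + \<Delta>t *\<^sub>R (transpose (G n j) *v midpoint r q) \<longleftrightarrow> r = transpose (\<Phi> n j) *v q"
    if nj: "n < M" "j \<in> {1..Np}" for n j q r
  proof (rule implicit_midpoint_transpose_iff)
    fix a
    show "\<Phi> n j *v a = a + \<Delta>t *\<^sub>R (G n j *v midpoint a (\<Phi> n j *v a))"
      unfolding \<Phi>_D[OF nj] by (subst D_eq[OF nj]) simp
  qed
  \<comment> \<open>The contribution of marker \<open>j\<close> to the gradient with respect to the \<open>n\<close>-th control.\<close>
  define f where
    "f n j = (\<chi> k. \<Delta>t * (midpoint (p n j) (p (Suc n) j) \<bullet> v k (midpoint (X n j) (X (Suc n) j))))" for n j
  have adj: "p (Suc n) j \<bullet> D n j (a, c) = p n j \<bullet> a + f n j \<bullet> c"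
    if nj: "n < M" "j \<in> {1..Np}" for n j a c
  proof -
    have "p (Suc n) j \<bullet> D n j (a, c) = p n j \<bullet> a + midpoint (p n j) (p (Suc n) j) \<bullet>
        (\<Delta>t *\<^sub>R (\<Sum>k\<in>UNIV. c $ k *\<^sub>R v k (midpoint (X n j) (X (Suc n) j))))"
      by (rule midpoint_adjoint_identity[OF D_eq[OF nj] p_step[OF nj]])
    then show ?thesis
      by (simp add: f_def inner_vec_def[of "vec_lambda _"] inner_sum_right sum_distrib_left mult_ac)
  qed
  have g_f: "(\<chi> k. \<gamma> k * \<Delta>t * u n $ k) + (\<Sum>j = 1..Np. f n j) = g n" if "n < M" for n
    by (simp add: vec_eq_iff g_eq[OF that] f_def sum_component sum_distrib_left)
  \<comment> \<open>\<open>traj F X0 u M\<close> and \<open>X M\<close> are known to agree only at the indices \<open>1..Np\<close>;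
    the length depends on no others.\<close>
  have final: "p M j = grad (\<lambda>x. - reg_length Np \<epsilon> ((traj F X0 u M)(j := x))) (traj F X0 u M j)"
    if "j \<in> {1..Np}" for j
  proof -
    have "reg_length Np \<epsilon> ((X M)(j := x)) = reg_length Np \<epsilon> ((traj F X0 u M)(j := x))" for x
      by (rule reg_length_cong) (simp add: traj_u)
    with that show ?thesis by (simp add: p_final traj_u)
  qed
  have "has_control_gradient M Jh g u"
  proof (rule has_control_gradientI)
    show "Jh w = Jh w'" if "\<And>n. n < M \<Longrightarrow> w n = w' n" for w w'
      unfolding Jh_eq by (rule cost_cong) (rule that)
    show "((\<lambda>b :: nat \<Rightarrow>\<^sub>C (real^'k). Jh (\<lambda>n. u n + apply_bcontfun b n)) has_derivative
       (\<lambda>b. \<Sum>n<M. g n \<bullet> apply_bcontfun b n)) (at 0)"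
    proof -
      have "((\<lambda>b :: nat \<Rightarrow>\<^sub>C (real^'k). u n + apply_bcontfun b n) has_derivative
         (\<lambda>b. apply_bcontfun b n)) (at 0)" for n
        by (auto intro!: derivative_eq_intros bounded_linear_imp_has_derivative
            bounded_linear_apply_bcontfun)
      from cost_has_derivative[where w = "\<lambda>b n. u n + apply_bcontfun b n" and F = F and p = p and D = D and f = f
            and M = M and Np = Np and ?X0.0 = X0 and \<Delta>t = \<Delta>t and \<gamma> = \<gamma>, OF eps this _ adj] show ?thesis
        by (simp add: Jh_eq F_D traj_u final g_f del: One_nat_def)
    qed
  qed
  moreover have "((\<lambda>s. Jh (upd_control u k n s)) has_real_derivative g n $ k) (at (u n $ k))"
    if "n < M" for n k
  proof -
    \<comment> \<open>Moving the single number \<open>u n $ k\<close> is an affine curve of controls.\<close>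
    have eq: "upd_control u k n s i = u i + (if i = n then (s - u n $ k) *\<^sub>R axis k 1 else 0)" for s i
      by (auto simp: upd_control_def vec_eq_iff axis_def)
    have u0: "upd_control u k n (u n $ k) = u" by (simp add: eq fun_eq_iff)
    have "((\<lambda>s. upd_control u k n s i) has_derivative
        (\<lambda>s. if i = n then s *\<^sub>R axis k 1 else 0)) (at (u n $ k))" for i
      unfolding eq by (cases "i = n") (auto intro!: derivative_eq_intros)
    from cost_has_derivative[where w = "upd_control u k n" and F = F and p = p and D = D and f = f
          and M = M and Np = Np and ?X0.0 = X0 and \<Delta>t = \<Delta>t and \<gamma> = \<gamma>, OF eps this _ adj]
    have "((\<lambda>s. Jh (upd_control u k n s)) has_derivative
       (\<lambda>s. \<Sum>i<M. g i \<bullet> (if i = n then s *\<^sub>R axis k 1 else 0))) (at (u n $ k))"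
      by (simp add: Jh_eq u0 F_D traj_u final g_f del: One_nat_def)
    moreover have "(\<Sum>i<M. g i \<bullet> (if i = n then s *\<^sub>R axis k 1 else 0)) = g n $ k * s" for s
      using that by (simp add: if_distrib[of "\<lambda>x. _ \<bullet> x"] inner_axis mult.commute cong: if_cong)
    ultimately show ?thesis by (simp add: has_field_derivative_def)
  qed
  moreover have "p n j = transpose (\<Phi> n j) *v p (Suc n) j" if "n < M" "j \<in> {1..Np}" for n j
    using step_iff[OF that] p_step[OF that] by blast
  ultimately show ?thesis using step_iff by blast
qed

end
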